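(* Let $H$ be a rational symmetric matrix indexed by a finite set $V$, let $a\in V$, and suppose $\operatorname{supp}_H(e_a)=-\operatorname{supp}_H(e_a)$. Then for every $b\in V$ with $b\neq a$ and every positive odd integer $r$, \[ H^r\text{ has PST from }a\text{ to }b\quad\Longleftrightarrow\quad H\text{ has PST from }a\text{ to }b. \] In particular, for the adjacency matrix $A$ of every finite bipartite graph, all distinct vertices $a,b$ and every positive odd integer $r$, $A^r$ has PST from $a$ to $b$ if and only if $A$ has PST from $a$ to $b$.
   Context: Graphs are finite and simple. For a finite set $V$ (elements are called vertices), $e_v$ denotes the standard basis vector indexed by $v\in V$. For a real symmetric matrix $H$ indexed by $V$ with spectral decomposition $H=\sum_{\lambda\in\operatorname{Spec}(H)}\lambda E_\lambda$ ($E_\lambda$ the orthogonal projection onto the $\lambda$-eigenspace), and a vector $x$, put $\operatorname{supp}_H(x)=\{\lambda\in\operatorname{Spec}(H):E_\lambda x\neq 0\}$. For a set $S\subseteq\mathbb R$, $-S=\{-s:s\in S\}$. A rational symmetric matrix is a symmetric matrix with entries in $\mathbb Q$. A real symmetric matrix $K$ has perfect state transfer (PST) from $a$ to $b$ if $\exp(-\mathrm i\tau K)e_a=\gamma e_b$ for some $\tau>0$ and some $\gamma\in\mathbb C$ with $|\gamma|=1$. *)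

theory Defs
  imports "HOL-Analysis.Analysis"
begin

text \<open>
  Matrices indexed by a finite set \<open>V\<close> are rendered with a type \<open>'v\<close> of class \<^class>\<open>finite\<close>
  in the role of \<open>V\<close>; the standard basis vector \<open>e\<^sub>v\<close> is \<open>axis v 1\<close>.
\<close>

definition rational_symmetric :: "real^'v^'v \<Rightarrow> bool" where
  "rational_symmetric H \<longleftrightarrow> transpose H = H \<and> (\<forall>u v. H $ u $ v \<in> \<rat>)"

text \<open>
  The power operation \<open>^\<close> on \<open>'a^'v^'v\<close> is not available for the matrix product
  (multiplication on vectors is componentwise), and neither is \<^const>\<open>exp\<close>.
\<close>

primrec mat_pow :: "'a::semiring_1^'v^'v \<Rightarrow> nat \<Rightarrow> 'a^'v^'v" where
  "mat_pow M 0 = mat 1"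
| "mat_pow M (Suc k) = M ** mat_pow M k"

definition mat_exp :: "complex^'v^'v \<Rightarrow> complex^'v^'v" where
  "mat_exp M = (\<Sum>k. (1 / fact k) *\<^sub>R mat_pow M k)"

definition eigenspace :: "real^'v^'v \<Rightarrow> real \<Rightarrow> (real^'v) set" where
  "eigenspace H l = {x. H *v x = l *\<^sub>R x}"

definition Spec :: "real^'v^'v \<Rightarrow> real set" where
  "Spec H = {l. \<exists>x. x \<noteq> 0 \<and> x \<in> eigenspace H l}"

definition orth_proj :: "'a::euclidean_space set \<Rightarrow> 'a \<Rightarrow> 'a" where
  "orth_proj S x = (THE y. y \<in> S \<and> (\<forall>z\<in>S. orthogonal (x - y) z))"

definition eig_supp :: "real^'v^'v \<Rightarrow> real^'v \<Rightarrow> real set" where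
  "eig_supp H x = {l \<in> Spec H. orth_proj (eigenspace H l) x \<noteq> 0}"

definition PST :: "real^'v^'v \<Rightarrow> 'v \<Rightarrow> 'v \<Rightarrow> bool" where
  "PST K a b \<longleftrightarrow>
    (\<exists>(\<tau>::real) (\<gamma>::complex). \<tau> > 0 \<and> norm \<gamma> = 1 \<and>
      mat_exp (\<chi> u v. - \<i> * complex_of_real \<tau> * complex_of_real (K $ u $ v)) *v axis a 1
        = \<gamma> *s axis b 1)"

text \<open>A graph on \<open>'v\<close> is given by its adjacency relation, which contains both orientations of an edge.\<close>

definition simple_graph :: "'v rel \<Rightarrow> bool" where
  "simple_graph E \<longleftrightarrow> sym E \<and> irrefl E"

definition bipartite :: "'v rel \<Rightarrow> bool" where
  "bipartite E \<longleftrightarrow> (\<exists>X. \<forall>(u, v) \<in> E. u \<in> X \<longleftrightarrow> v \<notin> X)"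

definition adj_matrix :: "'v rel \<Rightarrow> real^'v^'v" where
  "adj_matrix E = (\<chi> u v. if (u, v) \<in> E then 1 else 0)"

end

(* Write H = sum of l E_l over the spectrum, and S = supp_H(e_a).  Comparing eigencomponents, H^r has
   PST from a to b iff for some t > 0 and unimodular g there are signs s_l with E_l e_b = s_l E_l e_a and
   exp(-i t l^r) = g s_l on S (and E_l e_b = 0 off S).

   As S = -S and r is odd, this forces l^r = n_l beta with n_l integers.  The sum of the distinct values
   of l^(2r) on S is rational, being up to sign a coefficient of the minimal polynomial of the rational
   matrix H^(2r) relative to e_a; hence beta^2 and all l^(2r) are rational.  Since H has real spectrum,
   l^2 is then an eigenvalue of H^2 with a rational eigenvector, so it is rational as well, and the
   ratios of elements of S are rational.

   So S = omega M with M a set of integers, M = -M and gcd M = 1.  Put t' = t omega^r.  Then 4 t' m^r is a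
   multiple of 2 pi on M, so 2 t' / pi is an integer, which leaves only the residues of m^r modulo 4.
   If that integer is odd, all m in M are odd; in either case exp(-i t' m^r) is the same for every
   odd r, and PST passes between odd powers after rescaling the time. *)

theory Submission
  imports Defs "HOL-Computational_Algebra.Polynomial" "HOL-Computational_Algebra.Primes"
    "HOL-Library.Real_Mod"
begin

subsection \<open>Spectral decomposition and perfect state transfer\<close>

lemma symmetric_inner_mult:
  fixes H :: "real^'v^'v"
  assumes "transpose H = H"
  shows "(H *v x) \<bullet> y = x \<bullet> (H *v y)"
  using dot_lmul_matrix[of x H y] assms
  by (metis matrix_transpose_mul transpose_matrix_vector vector_transpose_matrix)

lemma eigenspaces_orthogonal:
  fixes H :: "real^'v^'v"
  assumes "transpose H = H" "x \<in> eigenspace H l" "y \<in> eigenspace H m" "l \<noteq> m"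
  shows "x \<bullet> y = 0"
proof -
  have "l * (x \<bullet> y) = m * (x \<bullet> y)"
    using symmetric_inner_mult[OF assms(1), of x y] assms(2,3) by (simp add: eigenspace_def)
  then show ?thesis using assms(4) by simp
qed

lemma subspace_eigenspace:
  fixes H :: "real^'v^'v"
  shows "subspace (eigenspace H l)"
  by (auto simp: subspace_def eigenspace_def matrix_vector_right_distrib scaleR_right_distrib
      matrix_vector_mult_scaleR)

lemma orth_proj_eqI:
  assumes "subspace S" "y \<in> S" "\<And>z. z \<in> S \<Longrightarrow> (x - y) \<bullet> z = 0"
  shows "orth_proj S x = y"
  unfolding orth_proj_def
proof (rule the_equality)
  show "y \<in> S \<and> (\<forall>z\<in>S. orthogonal (x - y) z)"
    using assms by (simp add: orthogonal_def)
next
  fix y' assume y': "y' \<in> S \<and> (\<forall>z\<in>S. orthogonal (x - y') z)"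
  have "y - y' \<in> S" using assms(1,2) y' by (simp add: subspace_diff)
  then have "(x - y') \<bullet> (y - y') = 0" "(x - y) \<bullet> (y - y') = 0"
    using y' assms(3) by (auto simp: orthogonal_def)
  then have "(y - y') \<bullet> (y - y') = 0" by (simp add: inner_diff_left)
  then show "y' = y" by simp
qed

lemma orth_proj_subspace:
  assumes "subspace S"
  shows "orth_proj S x \<in> S" and "z \<in> S \<Longrightarrow> (x - orth_proj S x) \<bullet> z = 0"
proof -
  obtain y w where y: "y \<in> span S" "\<And>w'. w' \<in> span S \<Longrightarrow> orthogonal w w'" "x = y + w"
    using orthogonal_subspace_decomp_exists by blast
  have sp: "span S = S" using assms by (simp add: span_eq_iff)
  have eq: "orth_proj S x = y"
    using y sp by (intro orth_proj_eqI[OF assms]) (auto simp: orthogonal_def)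
  show "orth_proj S x \<in> S" using eq y sp by simp
  show "z \<in> S \<Longrightarrow> (x - orth_proj S x) \<bullet> z = 0" using eq y sp by (auto simp: orthogonal_def)
qed

text \<open>Eigenvectors chosen one per eigenvalue are pairwise orthogonal, hence independent, so
  the dimension bounds their number.\<close>

lemma finite_Spec:
  fixes H :: "real^'v^'v"
  assumes "transpose H = H"
  shows "finite (Spec H)"
proof -
  have "\<forall>l\<in>Spec H. \<exists>x. x \<noteq> 0 \<and> x \<in> eigenspace H l" by (auto simp: Spec_def)
  then obtain X where X: "\<And>l. l \<in> Spec H \<Longrightarrow> X l \<noteq> 0 \<and> X l \<in> eigenspace H l" by metis
  have inj: "inj_on X (Spec H)"
    by (metis X assms eigenspaces_orthogonal inj_onI inner_eq_zero_iff)
  have "pairwise orthogonal (X ` Spec H)"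
    using X eigenspaces_orthogonal[OF assms] unfolding pairwise_def orthogonal_def by blast
  then have "independent (X ` Spec H)"
    using X by (intro pairwise_orthogonal_independent) auto
  then show ?thesis using inj independent_bound finite_imageD by blast
qed

text \<open>A maximiser of the quadratic form on the unit sphere of the subspace is an eigenvector.\<close>

lemma symmetric_invariant_subspace_eigenvector:
  fixes H :: "real^'v^'v"
  assumes sym: "transpose H = H" and sub: "subspace U" and inv: "\<And>x. x \<in> U \<Longrightarrow> H *v x \<in> U"
    and ne: "w \<in> U" "w \<noteq> 0"
  shows "\<exists>x l. x \<in> U \<and> x \<noteq> 0 \<and> x \<in> eigenspace H l"
proof -
  let ?K = "sphere 0 1 \<inter> U"
  have cpt: "compact ?K" using closed_subspace[OF sub] by (simp add: compact_Int_closed)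
  have "(1 / norm w) *\<^sub>R w \<in> ?K" using ne sub by (simp add: subspace_scale)
  then have "?K \<noteq> {}" by blast
  moreover have "continuous_on ?K (\<lambda>x. x \<bullet> (H *v x))"
    by (intro continuous_intros linear_continuous_on linear_linear[THEN iffD2] matrix_vector_mul_linear)
  ultimately obtain x where x: "x \<in> ?K" and xmax: "\<And>y. y \<in> ?K \<Longrightarrow> y \<bullet> (H *v y) \<le> x \<bullet> (H *v x)"
    using continuous_attains_sup[OF cpt] by blast
  define m where "m = x \<bullet> (H *v x)"
  \<comment> \<open>As \<open>m\<close> is the maximum, \<open>q\<close> is nonnegative on
    \<open>U\<close> and vanishes at \<open>x\<close>; half its gradient there is
    \<open>m *\<^sub>R x - H *v x\<close>, which therefore has to be zero.\<close>
  define q where "q z = m * (z \<bullet> z) - z \<bullet> (H *v z)" for z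
  have q0: "q z \<ge> 0" if "z \<in> U" for z
  proof (cases "z = 0")
    case True then show ?thesis by (simp add: q_def)
  next
    case False
    have "(1 / norm z) *\<^sub>R z \<in> ?K" using that False sub by (simp add: subspace_scale)
    from xmax[OF this] have "(z \<bullet> (H *v z)) / (norm z)\<^sup>2 \<le> m"
      by (simp add: m_def matrix_vector_mult_scaleR power2_eq_square)
    then show ?thesis using False by (simp add: q_def divide_le_eq power2_norm_eq_inner split: if_splits)
  qed
  have xU: "x \<in> U" and xx: "x \<bullet> x = 1" using x by (auto simp: norm_eq_1)
  have qx: "q x = 0" by (simp add: q_def m_def xx)
  let ?d = "m *\<^sub>R x - H *v x"
  have dU: "?d \<in> U" using xU inv sub by (simp add: subspace_diff subspace_scale)
  have expand: "q (x + t *\<^sub>R ?d) = 2 * t * (?d \<bullet> ?d) + t\<^sup>2 * q ?d" for t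
  proof -
    have "q (x + t *\<^sub>R y) = q x + 2 * t * (?d \<bullet> y) + t\<^sup>2 * q y" for y
      using symmetric_inner_mult[OF sym, of x y]
      by (simp add: q_def matrix_vector_mult_scaleR matrix_vector_right_distrib inner_add_left
          inner_add_right inner_diff_left inner_commute power2_eq_square algebra_simps)
    then show ?thesis using qx by simp
  qed
  have "?d \<bullet> ?d = 0"
  proof (rule ccontr)
    assume "?d \<bullet> ?d \<noteq> 0"
    then have D: "?d \<bullet> ?d > 0" using inner_ge_zero[of ?d] by linarith
    \<comment> \<open>The step \<open>- e\<close> along \<open>?d\<close> is so short that the
      quadratic term cannot outweigh the negative linear one; the 1 keeps the denominator
      positive.\<close>
    define e where "e = (?d \<bullet> ?d) / (1 + q ?d)"
    have Q: "q ?d \<ge> 0" by (rule q0[OF dU])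
    have e: "e > 0" using D Q by (simp add: e_def)
    have "e * q ?d \<le> ?d \<bullet> ?d" using D Q by (simp add: e_def field_simps)
    moreover have "0 \<le> 2 * (- e) * (?d \<bullet> ?d) + (- e)\<^sup>2 * q ?d"
      using q0[of "x + (- e) *\<^sub>R ?d"] xU dU sub expand[of "- e"]
      by (metis subspace_add subspace_scale)
    then have "2 * (?d \<bullet> ?d) * e \<le> (e * q ?d) * e" by (simp add: power2_eq_square mult_ac)
    then have "2 * (?d \<bullet> ?d) \<le> e * q ?d" using e mult_le_cancel_right by (metis less_asym)
    ultimately show False using D by linarith
  qed
  then have "x \<in> eigenspace H m" by (simp add: eigenspace_def)
  moreover have "x \<noteq> 0" using xx by auto
  ultimately show ?thesis using xU by blast
qed

text \<open>The vectors orthogonal to all eigenspaces form an \<open>H\<close>-invariant subspace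
  containing the residual of \<open>v\<close>. A nonzero residual would thus yield an eigenvector
  orthogonal to itself.\<close>

lemma symmetric_spectral_decomposition:
  fixes H :: "real^'v^'v"
  assumes sym: "transpose H = H"
  shows "(\<Sum>l\<in>Spec H. orth_proj (eigenspace H l) v) = v"
proof (rule ccontr)
  let ?P = "\<lambda>l. orth_proj (eigenspace H l) v"
  let ?w = "v - (\<Sum>l\<in>Spec H. ?P l)"
  assume ne: "\<not> ?thesis"
  let ?U = "{w. \<forall>l. \<forall>z\<in>eigenspace H l. w \<bullet> z = 0}"
  have "?w \<bullet> z = 0" if z: "z \<in> eigenspace H l" for z l
  proof (cases "z = 0")
    case False
    then have l: "l \<in> Spec H" using z by (auto simp: Spec_def)
    have "(\<Sum>m\<in>Spec H. ?P m \<bullet> z) = ?P l \<bullet> z + (\<Sum>m\<in>Spec H - {l}. ?P m \<bullet> z)"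
      using finite_Spec[OF sym] l by (simp add: sum.remove)
    also have "(\<Sum>m\<in>Spec H - {l}. ?P m \<bullet> z) = 0"
      using eigenspaces_orthogonal[OF sym orth_proj_subspace(1)[OF subspace_eigenspace] z]
      by (intro sum.neutral) auto
    finally show ?thesis
      using orth_proj_subspace(2)[OF subspace_eigenspace z, of v]
      by (simp add: inner_diff_left inner_sum_left)
  qed simp
  then have "?w \<in> ?U" by blast
  moreover have "subspace ?U" by (auto simp: subspace_def inner_add_left)
  moreover have "H *v x \<in> ?U" if "x \<in> ?U" for x
    using that by (auto simp: symmetric_inner_mult[OF sym] eigenspace_def)
  moreover have "?w \<noteq> 0" using ne by auto
  ultimately obtain x l where x: "x \<in> ?U" "x \<noteq> 0" "x \<in> eigenspace H l"
    using symmetric_invariant_subspace_eigenvector[OF sym] by blast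
  then have "x \<bullet> x = 0" by blast
  then show False using x by simp
qed

lemma eigenvector_sum_eq_0:
  fixes H :: "real^'v^'v"
  assumes sym: "transpose H = H" and fin: "finite L"
    and z: "\<And>l. l \<in> L \<Longrightarrow> z l \<in> eigenspace H l" and "(\<Sum>l\<in>L. z l) = 0" and m: "m \<in> L"
  shows "z m = 0"
proof -
  have "0 = (\<Sum>l\<in>L. z l \<bullet> z m)" using assms(4) by (metis inner_sum_left inner_zero_left)
  also have "\<dots> = z m \<bullet> z m + (\<Sum>l\<in>L - {m}. z l \<bullet> z m)" using fin m by (simp add: sum.remove)
  also have "(\<Sum>l\<in>L - {m}. z l \<bullet> z m) = 0"
    using eigenspaces_orthogonal[OF sym z z[OF m]] by (intro sum.neutral) auto
  finally show ?thesis by simp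
qed

text \<open>The projection \<open>p\<close> of \<open>axis a 1\<close> satisfies
  \<open>axis a 1 \<bullet> p = p \<bullet> p\<close> and \<open>z $ a = p \<bullet> z\<close> for
  eigenvectors \<open>z\<close>. Membership can then be shown by exhibiting an eigenvector.\<close>

lemma eig_supp_axis_iff:
  fixes H :: "real^'v^'v"
  assumes sym: "transpose H = H"
  shows "l \<in> eig_supp H (axis a 1) \<longleftrightarrow> (\<exists>z. H *v z = l *\<^sub>R z \<and> z $ a \<noteq> 0)"
proof
  let ?p = "orth_proj (eigenspace H l) (axis a 1)"
  note P = orth_proj_subspace[OF subspace_eigenspace[of H l], where x = "axis a 1"]
  show "\<exists>z. H *v z = l *\<^sub>R z \<and> z $ a \<noteq> 0" if "l \<in> eig_supp H (axis a 1)"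
  proof -
    have "?p \<noteq> 0" using that by (simp add: eig_supp_def)
    moreover have "axis a 1 \<bullet> ?p = ?p \<bullet> ?p" using P(2)[OF P(1)] by (simp add: inner_diff_left)
    ultimately have "?p $ a \<noteq> 0" by (simp add: inner_axis')
    then show ?thesis using P(1) by (auto simp: eigenspace_def)
  qed
  assume "\<exists>z. H *v z = l *\<^sub>R z \<and> z $ a \<noteq> 0"
  then obtain z where z: "z \<in> eigenspace H l" "z $ a \<noteq> 0" by (auto simp: eigenspace_def)
  then have "z \<noteq> 0" by auto
  moreover have "?p \<noteq> 0" using P(2)[OF z(1)] z(2) by (auto simp: inner_diff_left inner_axis')
  ultimately show "l \<in> eig_supp H (axis a 1)" using z by (auto simp: eig_supp_def Spec_def)
qed

section \<open>Matrix powers, exponentials and transfer in eigencomponents\<close>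

lemma mat_pow_eigenvector:
  fixes K :: "real^'v^'v"
  assumes "K *v x = c *\<^sub>R x"
  shows "mat_pow K k *v x = c ^ k *\<^sub>R x"
  by (induction k)
    (simp_all add: matrix_vector_mul_assoc[symmetric] matrix_vector_mult_scaleR assms mult.commute)

lemma mat_pow_Rats:
  fixes H :: "real^'v^'v"
  assumes "\<And>u v. H $ u $ v \<in> \<rat>"
  shows "mat_pow H k $ u $ v \<in> \<rat>"
  by (induction k arbitrary: u v)
    (auto simp: mat_def matrix_matrix_mult_def assms intro!: Rats_sum Rats_mult)

lemma mat_pow_scaled_of_real:
  fixes K :: "real^'v^'v" and z :: complex
  shows "mat_pow (\<chi> u v. z * complex_of_real (K $ u $ v)) k =
    (\<chi> u v. z ^ k * complex_of_real (mat_pow K k $ u $ v))"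
proof (induction k)
  case 0
  show ?case by (simp add: vec_eq_iff mat_def)
next
  case (Suc k)
  then show ?case
    by (simp add: vec_eq_iff matrix_matrix_mult_def sum_distrib_left mult_ac)
qed

text \<open>Splitting each basis vector into eigenvectors splits the exponential series into scalar
  ones. The free function \<open>f\<close> lets \<open>K\<close> be a power of \<open>H\<close>
  decomposed along the eigenspaces of \<open>H\<close>.\<close>

lemma mat_exp_spectral:
  fixes K :: "real^'v^'v"
  assumes fin: "finite L"
    and dec: "\<And>v. (\<Sum>l\<in>L. p l v) = axis v 1"
    and eig: "\<And>l v. l \<in> L \<Longrightarrow> K *v p l v = f l *\<^sub>R p l v"
  shows "mat_exp (\<chi> u v. - \<i> * complex_of_real \<tau> * complex_of_real (K $ u $ v)) *v axis a 1
    = (\<chi> u. \<Sum>l\<in>L. cis (- (\<tau> * f l)) * complex_of_real (p l a $ u))"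
proof -
  let ?z = "- \<i> * complex_of_real \<tau>"
  let ?M = "(\<chi> u v. ?z * complex_of_real (K $ u $ v)) :: complex^'v^'v"
  have pow: "mat_pow K k $ u $ v = (\<Sum>l\<in>L. f l ^ k * p l v $ u)" for k u v
  proof -
    have "mat_pow K k $ u $ v = (mat_pow K k *v axis v 1) $ u"
      by (simp add: matrix_vector_mult_basis column_def)
    also have "mat_pow K k *v axis v 1 = (\<Sum>l\<in>L. mat_pow K k *v p l v)"
      by (simp add: dec[symmetric] linear_sum[OF matrix_vector_mul_linear])
    also have "\<dots> = (\<Sum>l\<in>L. f l ^ k *\<^sub>R p l v)"
      by (intro sum.cong refl mat_pow_eigenvector eig)
    finally show ?thesis by simp
  qed
  let ?R = "(\<chi> u v. \<Sum>l\<in>L. cis (- (\<tau> * f l)) * complex_of_real (p l v $ u)) :: complex^'v^'v"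
  have "(\<lambda>k. (1 / fact k) *\<^sub>R mat_pow ?M k) sums ?R"
    unfolding sums_def
  proof (intro vec_tendstoI)
    fix u v
    have "(\<lambda>k. \<Sum>l\<in>L. ((?z * f l) ^ k /\<^sub>R fact k) * complex_of_real (p l v $ u)) sums
       (\<Sum>l\<in>L. exp (?z * f l) * complex_of_real (p l v $ u))"
      by (intro sums_sum sums_mult2 exp_converges)
    moreover have "exp (?z * f l) = cis (- (\<tau> * f l))" for l
      by (simp add: cis_conv_exp mult_ac)
    moreover have "(\<Sum>l\<in>L. ((?z * f l) ^ k /\<^sub>R fact k) * complex_of_real (p l v $ u))
        = ((1 / fact k) *\<^sub>R mat_pow ?M k) $ u $ v" for k
      unfolding mat_pow_scaled_of_real
      by (simp add: pow sum_distrib_left scaleR_conv_of_real[where 'a = complex] power_mult_distrib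
          divide_inverse power_minus[of "_ * _"] mult_ac)
    ultimately show "(\<lambda>n. (\<Sum>i<n. (1 / fact i) *\<^sub>R mat_pow ?M i) $ u $ v) \<longlonglongrightarrow> ?R $ u $ v"
      by (simp add: sums_def)
  qed
  then have "mat_exp ?M = ?R" unfolding mat_exp_def by (rule sums_unique[symmetric])
  then show ?thesis
    by (simp add: vec_eq_iff matrix_vector_mult_def axis_def if_distrib[of "(*) _"] cong: if_cong)
qed

text \<open>The vectors involved do not depend on \<open>r\<close>, which enters only through the
  phases, so different powers become comparable.\<close>

lemma PST_mat_pow_iff:
  fixes H :: "real^'v^'v"
  assumes sym: "transpose H = H"
  defines "p \<equiv> \<lambda>l v. orth_proj (eigenspace H l) (axis v 1)"
  shows "PST (mat_pow H r) a b \<longleftrightarrow>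
    (\<exists>\<tau> \<gamma>. \<tau> > 0 \<and> norm \<gamma> = 1 \<and>
      (\<forall>l\<in>Spec H. \<forall>u. cis (- (\<tau> * l ^ r)) * complex_of_real (p l a $ u)
        = \<gamma> * complex_of_real (p l b $ u)))"
proof -
  have dec: "(\<Sum>l\<in>Spec H. p l v) = axis v 1" for v
    unfolding p_def by (rule symmetric_spectral_decomposition[OF sym])
  have pE: "p l v \<in> eigenspace H l" for l v
    unfolding p_def by (rule orth_proj_subspace(1)[OF subspace_eigenspace])
  have "mat_pow H r *v p l v = l ^ r *\<^sub>R p l v" for l v
    using pE[of l v] by (intro mat_pow_eigenvector) (simp add: eigenspace_def)
  note spec = mat_exp_spectral[OF finite_Spec[OF sym] dec this]
  have "(\<chi> u. \<Sum>l\<in>Spec H. cis (- (\<tau> * l ^ r)) * complex_of_real (p l a $ u)) = \<gamma> *s axis b 1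
    \<longleftrightarrow> (\<forall>l\<in>Spec H. \<forall>u. cis (- (\<tau> * l ^ r)) * complex_of_real (p l a $ u)
        = \<gamma> * complex_of_real (p l b $ u))" (is "?L \<longleftrightarrow> ?R") for \<tau> \<gamma>
  proof -
    have axis: "axis b 1 $ u = (\<Sum>l\<in>Spec H. complex_of_real (p l b $ u))" for u
    proof -
      have "axis b 1 $ u = complex_of_real (axis b 1 $ u)" by (simp add: axis_def)
      also have "\<dots> = (\<Sum>l\<in>Spec H. complex_of_real (p l b $ u))" by (simp add: dec[symmetric])
      finally show ?thesis .
    qed
    have "?L \<longleftrightarrow> (\<forall>u. (\<Sum>l\<in>Spec H. cis (- (\<tau> * l ^ r)) * complex_of_real (p l a $ u)
      - \<gamma> * complex_of_real (p l b $ u)) = 0)"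
      by (simp add: vec_eq_iff axis sum_subtractf sum_distrib_left)
    \<comment> \<open>The projections are real, so real and imaginary parts are taken first;
      orthogonality of real eigenspaces then separates the eigenvalues.\<close>
    also have "\<dots> \<longleftrightarrow>
      (\<Sum>l\<in>Spec H. Re (cis (- (\<tau> * l ^ r))) *\<^sub>R p l a - Re \<gamma> *\<^sub>R p l b) = 0 \<and>
      (\<Sum>l\<in>Spec H. Im (cis (- (\<tau> * l ^ r))) *\<^sub>R p l a - Im \<gamma> *\<^sub>R p l b) = 0"
      by (auto simp: vec_eq_iff complex_eq_iff)
    also have "\<dots> \<longleftrightarrow>
      (\<forall>l\<in>Spec H. Re (cis (- (\<tau> * l ^ r))) *\<^sub>R p l a - Re \<gamma> *\<^sub>R p l b = 0) \<and>
      (\<forall>l\<in>Spec H. Im (cis (- (\<tau> * l ^ r))) *\<^sub>R p l a - Im \<gamma> *\<^sub>R p l b = 0)"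
    proof -
      have "(\<Sum>l\<in>Spec H. c l *\<^sub>R p l a - d *\<^sub>R p l b) = 0 \<longleftrightarrow>
        (\<forall>l\<in>Spec H. c l *\<^sub>R p l a - d *\<^sub>R p l b = 0)" for c d
        using eigenvector_sum_eq_0[OF sym finite_Spec[OF sym],
            of "\<lambda>l. c l *\<^sub>R p l a - d *\<^sub>R p l b"]
          pE subspace_eigenspace subspace_diff subspace_scale
        by (metis (no_types, lifting) sum.neutral)
      from this[of "\<lambda>l. Re (cis (- (\<tau> * l ^ r)))" "Re \<gamma>"]
        this[of "\<lambda>l. Im (cis (- (\<tau> * l ^ r)))" "Im \<gamma>"]
      show ?thesis by simp
    qed
    also have "\<dots> \<longleftrightarrow> ?R" by (auto simp: vec_eq_iff complex_eq_iff)
    finally show ?thesis .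
  qed
  then show ?thesis unfolding PST_def by (simp only: spec)
qed

subsection \<open>Rationality of eigenvalues\<close>

text \<open>A \<open>\<rat>\<close>-linear projection of the reals onto the rationals. Applied to
  coordinates, it turns real solutions of rational linear equations into rational ones.\<close>

definition rational_retraction :: "(real \<Rightarrow> real) \<Rightarrow> bool" where
  "rational_retraction \<phi> \<longleftrightarrow> Modules.additive \<phi> \<and> \<phi> 1 = 1 \<and> range \<phi> \<subseteq> \<rat> \<and>
    (\<forall>q\<in>\<rat>. \<forall>x. \<phi> (q * x) = q * \<phi> x)"

text \<open>The set {1} is independent over the rationals, so sending 1 to 1 extends to a
  \<open>\<rat>\<close>-linear map on the reals.\<close>

lemma rational_retraction_exists: "\<exists>\<phi>. rational_retraction \<phi>"
proof -
  interpret vector_space_pair "\<lambda>(q::rat) (x::real). of_rat q * x" "(*) :: rat \<Rightarrow> rat \<Rightarrow> rat"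
    by unfold_locales (simp_all add: of_rat_add of_rat_mult algebra_simps)
  have "vs1.independent {1}" by (simp add: vs1.dependent_single)
  from linear_independent_extend[OF this, of "\<lambda>_. 1"] obtain g
    where g: "Vector_Spaces.linear (\<lambda>(q::rat) (x::real). of_rat q * x) (*) g" and g1: "g 1 = 1" by auto
  interpret g: Vector_Spaces.linear "\<lambda>(q::rat) (x::real). of_rat q * x" "(*)" g by (rule g)
  have "rational_retraction (\<lambda>x. of_rat (g x))"
    unfolding rational_retraction_def Modules.additive_def
    by (auto simp: g.add of_rat_add g1 of_rat_mult g.scale elim!: Rats_cases)
  then show ?thesis by blast
qed

lemma rational_retraction_fix: "rational_retraction \<phi> \<Longrightarrow> q \<in> \<rat> \<Longrightarrow> \<phi> q = q"
  unfolding rational_retraction_def by (metis mult.right_neutral)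

lemma rational_retraction_sum:
  assumes "rational_retraction \<phi>" "\<And>i. i \<in> I \<Longrightarrow> q i \<in> \<rat>"
  shows "\<phi> (\<Sum>i\<in>I. q i * x i) = (\<Sum>i\<in>I. q i * \<phi> (x i))"
  using assms by (simp add: Modules.additive.sum rational_retraction_def cong: sum.cong)

lemma rational_kernel_vector:
  fixes M :: "real^'n^'m"
  assumes M: "\<And>u v. M $ u $ v \<in> \<rat>" and x: "M *v x = 0" "x \<noteq> 0"
  shows "\<exists>y. y \<noteq> 0 \<and> (\<forall>u. y $ u \<in> \<rat>) \<and> M *v y = 0"
proof -
  obtain \<phi> where \<phi>: "rational_retraction \<phi>" using rational_retraction_exists by blast
  obtain w where w: "x $ w \<noteq> 0" using x(2) by (auto simp: vec_eq_iff)
  \<comment> \<open>One coordinate is normalised to 1, which the retraction fixes, so that the image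
    is nonzero.\<close>
  define x' where "x' = (1 / x $ w) *\<^sub>R x"
  define y where "y = (\<chi> u. \<phi> (x' $ u))"
  have "y $ w = 1" using w \<phi> by (simp add: y_def x'_def rational_retraction_def)
  then have "y \<noteq> 0" by auto
  moreover have "y $ u \<in> \<rat>" for u using \<phi> by (auto simp: y_def rational_retraction_def)
  moreover have "M *v y = 0"
  proof -
    have "(M *v y) $ u = \<phi> ((M *v x') $ u)" for u
      by (simp add: matrix_vector_mult_def y_def rational_retraction_sum[OF \<phi> M])
    moreover have "M *v x' = 0" by (simp add: x'_def matrix_vector_mult_scaleR x(1))
    ultimately show ?thesis
      using rational_retraction_fix[OF \<phi>, of 0] by (simp add: vec_eq_iff)
  qed
  ultimately show ?thesis by blast
qed

lemma mat_pow_symmetric_spectral: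
  fixes H :: "real^'v^'v"
  assumes sym: "transpose H = H"
  shows "mat_pow H k *v x = (\<Sum>l\<in>Spec H. l ^ k *\<^sub>R orth_proj (eigenspace H l) x)"
proof -
  have "mat_pow H k *v x = mat_pow H k *v (\<Sum>l\<in>Spec H. orth_proj (eigenspace H l) x)"
    by (simp add: symmetric_spectral_decomposition[OF sym])
  also have "\<dots> = (\<Sum>l\<in>Spec H. mat_pow H k *v orth_proj (eigenspace H l) x)"
    by (simp add: linear_sum[OF matrix_vector_mul_linear])
  also have "\<dots> = (\<Sum>l\<in>Spec H. l ^ k *\<^sub>R orth_proj (eigenspace H l) x)"
    using orth_proj_subspace(1)[OF subspace_eigenspace]
    by (intro sum.cong refl mat_pow_eigenvector) (auto simp: eigenspace_def)
  finally show ?thesis .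
qed

text \<open>The kernel of the rational matrix \<open>H\<^sup>2\<^sup>r - \<mu>\<^sup>2\<^sup>r\<close> is the kernel of \<open>H\<^sup>2 - \<mu>\<^sup>2\<close>, since
  \<open>H\<close> has only real eigenvalues; a rational vector in it shows that \<open>\<mu>\<^sup>2\<close> is rational.\<close>

lemma eigenvalue_square_Rats:
  fixes H :: "real^'v^'v"
  assumes sym: "transpose H = H" and rat: "\<And>u v. H $ u $ v \<in> \<rat>"
    and \<mu>: "\<mu> \<in> Spec H" "\<mu> ^ (2 * r) \<in> \<rat>" and r: "r > 0"
  shows "\<mu>\<^sup>2 \<in> \<rat>"
proof -
  let ?c = "\<mu> ^ (2 * r)"
  let ?M = "mat_pow H (2 * r) - mat ?c"
  have mat: "mat ?c *v x = ?c *\<^sub>R x" for x :: "real^'v"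
    by (simp add: mat_def matrix_vector_mult_def vec_eq_iff if_distrib[of "\<lambda>x. x * _"] cong: if_cong)
  obtain x where x: "x \<noteq> 0" "H *v x = \<mu> *\<^sub>R x" using \<mu>(1) by (auto simp: Spec_def eigenspace_def)
  have "?M *v x = 0"
    by (simp add: matrix_vector_mult_diff_rdistrib mat mat_pow_eigenvector[OF x(2)])
  moreover have "?M $ u $ v \<in> \<rat>" for u v
    using mat_pow_Rats[OF rat, of "2 * r" u v] \<mu>(2) by (simp add: mat_def)
  ultimately obtain y where y: "y \<noteq> 0" "\<And>u. y $ u \<in> \<rat>" "?M *v y = 0"
    using rational_kernel_vector[OF _ _ x(1), of ?M] by blast
  let ?P = "\<lambda>l. orth_proj (eigenspace H l) y"
  have "(\<Sum>l\<in>Spec H. (l ^ (2 * r) - ?c) *\<^sub>R ?P l) = mat_pow H (2 * r) *v y - ?c *\<^sub>R y"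
    by (simp add: mat_pow_symmetric_spectral[OF sym] scaleR_diff_left sum_subtractf
        flip: scaleR_sum_right) (simp add: symmetric_spectral_decomposition[OF sym])
  also have "\<dots> = 0" using y(3) by (simp add: matrix_vector_mult_diff_rdistrib mat)
  finally have z: "(l ^ (2 * r) - ?c) *\<^sub>R ?P l = 0" if "l \<in> Spec H" for l
    using eigenvector_sum_eq_0[OF sym finite_Spec[OF sym], of "\<lambda>l. (l ^ (2 * r) - ?c) *\<^sub>R ?P l" l] that
      subspace_scale[OF subspace_eigenspace orth_proj_subspace(1)[OF subspace_eigenspace]] by blast
  \<comment> \<open>Where the component of \<open>y\<close> is nonzero, the squares have equal
    \<open>r\<close>-th powers, and they are equal because they are nonnegative.\<close>
  have "l\<^sup>2 *\<^sub>R ?P l = \<mu>\<^sup>2 *\<^sub>R ?P l" if "l \<in> Spec H" for l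
  proof (cases "?P l = 0")
    case False
    then have "(l\<^sup>2) ^ r = (\<mu>\<^sup>2) ^ r" using z[OF that] by (simp add: power_mult)
    then show ?thesis using r power_eq_imp_eq_base[of "l\<^sup>2" r "\<mu>\<^sup>2"] by simp
  qed simp
  then have "mat_pow H 2 *v y = (\<Sum>l\<in>Spec H. \<mu>\<^sup>2 *\<^sub>R ?P l)"
    unfolding mat_pow_symmetric_spectral[OF sym] by (intro sum.cong) auto
  also have "\<dots> = \<mu>\<^sup>2 *\<^sub>R y"
    by (simp add: symmetric_spectral_decomposition[OF sym] flip: scaleR_sum_right)
  finally have eq: "mat_pow H 2 *v y = \<mu>\<^sup>2 *\<^sub>R y" .
  obtain w where w: "y $ w \<noteq> 0" using y(1) by (auto simp: vec_eq_iff)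
  have "(mat_pow H 2 *v y) $ w \<in> \<rat>"
    using mat_pow_Rats[OF rat] y(2) by (auto simp: matrix_vector_mult_def intro!: Rats_sum Rats_mult)
  then have "(\<mu>\<^sup>2 * y $ w) / y $ w \<in> \<rat>" using eq y(2) by (intro Rats_divide) auto
  then show ?thesis using w by simp
qed

section \<open>Minimal polynomial relative to a basis vector\<close>

lemma poly_linear_factors:
  fixes T :: "'a::idom set"
  assumes "finite T"
  defines "p \<equiv> \<Prod>t\<in>T. [:- t, 1:]"
  shows "degree p = card T" "coeff p (card T) = 1"
proof -
  show d: "degree p = card T" unfolding p_def
    by (subst degree_prod_eq_sum_degree) auto
  show "coeff p (card T) = 1" unfolding d[symmetric] unfolding p_def lead_coeff_prod by simp
qed

lemma poly_linear_factors_subleading_coeff: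
  fixes T :: "'a::idom set"
  assumes "finite T" "T \<noteq> {}"
  shows "coeff (\<Prod>t\<in>T. [:- t, 1:]) (card T - 1) = - \<Sum>T"
  using assms
proof (induction T rule: finite_ne_induct)
  case (singleton x)
  then show ?case by simp
next
  case (insert x F)
  obtain n where n: "card F = Suc n" using insert by (metis card_gt_0_iff Suc_pred)
  then show ?case using insert poly_linear_factors(2)[OF insert(1)] by simp
qed

text \<open>The polynomial with simple roots \<open>l\<^sup>n\<close> is the minimal polynomial of \<open>H\<^sup>n\<close> relative to \<open>e\<^sub>a\<close>.
  A \<open>\<rat>\<close>-linear retraction of its coefficients gives another monic annihilating polynomial
  of the same degree, so its coefficients are rational.\<close>

lemma eig_supp_polynomial_Rats:
  fixes H :: "real^'v^'v" and a :: 'v and n :: nat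
  assumes sym: "transpose H = H" and rat: "\<And>u v. H $ u $ v \<in> \<rat>"
  defines "T \<equiv> (\<lambda>l. l ^ n) ` eig_supp H (axis a 1)"
  shows "coeff (\<Prod>t\<in>T. [:- t, 1:]) i \<in> \<rat>"
proof -
  obtain \<phi> where \<phi>: "rational_retraction \<phi>" using rational_retraction_exists by blast
  let ?P = "\<lambda>l. orth_proj (eigenspace H l) (axis a 1)"
  let ?p = "\<Prod>t\<in>T. [:- t, 1:]"
  let ?q = "map_poly \<phi> ?p"
  have fin: "finite T"
    unfolding T_def eig_supp_def using finite_Spec[OF sym] by simp
  note deg = poly_linear_factors[OF fin]
  have \<phi>0: "\<phi> 0 = 0" "\<phi> 1 = 1" using rational_retraction_fix[OF \<phi>] by auto
  have cq: "coeff ?q i = \<phi> (coeff ?p i)" for i using \<phi>0 by (simp add: coeff_map_poly)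
  have dq: "degree ?q \<le> card T" by (intro degree_le) (auto simp: cq coeff_eq_0 deg(1) \<phi>0(1))
  \<comment> \<open>Both sides are coordinates of f(H^n) applied to \<open>axis a 1\<close>. The
    left one has rational weights on the coefficients of \<open>f\<close>, as the retraction needs;
    the right one shows the values of \<open>f\<close> at the \<open>l ^ n\<close>.\<close>
  have act: "(\<Sum>i\<le>card T. coeff f i * mat_pow H (n * i) $ u $ a)
      = (\<Sum>l\<in>Spec H. poly f (l ^ n) *\<^sub>R ?P l) $ u" if "degree f \<le> card T" for f u
  proof -
    have m: "mat_pow H k $ u $ a = (\<Sum>l\<in>Spec H. l ^ k * ?P l $ u)" for k
    proof -
      have "mat_pow H k $ u $ a = (mat_pow H k *v axis a 1) $ u"
        by (simp add: matrix_vector_mult_basis column_def)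
      then show ?thesis by (simp add: mat_pow_symmetric_spectral[OF sym])
    qed
    have "poly f x = (\<Sum>i\<le>card T. coeff f i * x ^ i)" for x
      unfolding poly_altdef using that by (intro sum.mono_neutral_left) (auto simp: coeff_eq_0)
    then show ?thesis
      by (simp add: m sum_distrib_left sum_distrib_right power_mult mult.assoc) (rule sum.swap)
  qed
  have "poly ?p (l ^ n) *\<^sub>R ?P l = 0" if "l \<in> Spec H" for l
    using that fin by (cases "?P l = 0") (auto simp: poly_prod T_def eig_supp_def)
  then have "(\<Sum>i\<le>card T. coeff ?p i * mat_pow H (n * i) $ u $ a) = 0" for u
    using act[of ?p u] deg(1) by (metis (no_types, lifting) order_refl sum.neutral zero_index)
  then have "(\<Sum>i\<le>card T. coeff ?q i * mat_pow H (n * i) $ u $ a) = 0" for u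
    using rational_retraction_sum[OF \<phi>, of "{..card T}" "\<lambda>i. mat_pow H (n * i) $ u $ a" "coeff ?p"]
      mat_pow_Rats[OF rat] \<phi>0(1) by (simp add: cq mult.commute)
  then have "(\<Sum>l\<in>Spec H. poly ?q (l ^ n) *\<^sub>R ?P l) = 0"
    using act[OF dq] by (simp add: vec_eq_iff)
  then have "poly ?q (l ^ n) *\<^sub>R ?P l = 0" if "l \<in> Spec H" for l
    using eigenvector_sum_eq_0[OF sym finite_Spec[OF sym], of "\<lambda>l. poly ?q (l ^ n) *\<^sub>R ?P l" l] that
      subspace_scale[OF subspace_eigenspace orth_proj_subspace(1)[OF subspace_eigenspace]] by blast
  then have "poly ?q t = 0" if "t \<in> T" for t using that by (auto simp: T_def eig_supp_def)
  moreover have "poly ?p t = 0" if "t \<in> T" for t using that fin by (auto simp: poly_prod)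
  \<comment> \<open>Both have degree at most \<open>card T\<close>, the same coefficient 1 there and
    \<open>card T\<close> common zeros, so their difference vanishes.\<close>
  ultimately have "?q = ?p"
    using deg dq \<phi>0(2) by (intro poly_eqI_degree_lead_coeff[of _ "card T" _ T]) (auto simp: cq)
  then have "coeff ?p i = \<phi> (coeff ?p i)" using cq by metis
  then show ?thesis using \<phi> by (metis rational_retraction_def range_subsetD)
qed

text \<open>By Vieta this is minus the subleading coefficient. Summing over the image counts each
  value of \<open>l ^ n\<close> once.\<close>

lemma eig_supp_power_sum_Rats:
  fixes H :: "real^'v^'v"
  assumes sym: "transpose H = H" and rat: "\<And>u v. H $ u $ v \<in> \<rat>"
  shows "\<Sum>((\<lambda>l. l ^ n) ` eig_supp H (axis a 1)) \<in> \<rat>"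
proof (cases "eig_supp H (axis a 1) = {}")
  case False
  have "finite (eig_supp H (axis a 1))" using finite_Spec[OF sym] by (simp add: eig_supp_def)
  then show ?thesis
    using eig_supp_polynomial_Rats[OF assms] poly_linear_factors_subleading_coeff False
    by (metis Rats_minus_iff finite_imageI image_is_empty)
qed simp

subsection \<open>Arithmetic of the transfer times\<close>

text \<open>By Bezout the gcd is an integral combination of the elements.\<close>

lemma Ints_mult_Gcd:
  fixes \<theta> :: real and A :: "int set"
  assumes "finite A" "\<And>a. a \<in> A \<Longrightarrow> \<theta> * of_int a \<in> \<int>"
  shows "\<theta> * of_int (Gcd A) \<in> \<int>"
  using assms
proof (induction A rule: finite_induct)
  case empty
  then show ?case by simp
next
  case (insert x F)
  obtain u v where uv: "u * x + v * Gcd F = gcd x (Gcd F)" using bezout_int by blast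
  have "of_int u * (\<theta> * of_int x) + of_int v * (\<theta> * of_int (Gcd F)) \<in> \<int>"
    using insert.IH insert.prems by (intro Ints_add Ints_mult[of "of_int _"]) auto
  also have "of_int u * (\<theta> * of_int x) + of_int v * (\<theta> * of_int (Gcd F))
      = \<theta> * of_int (u * x + v * Gcd F)" by (simp add: algebra_simps)
  finally show ?case by (simp add: uv)
qed

text \<open>A prime dividing every \<open>m ^ r\<close> divides every \<open>m\<close>.\<close>

lemma Gcd_power_image_eq_1:
  fixes M :: "int set"
  assumes "Gcd M = 1"
  shows "Gcd ((\<lambda>m. m ^ r) ` M) = 1"
proof -
  let ?g = "Gcd ((\<lambda>m. m ^ r) ` M)"
  have "\<not> p dvd ?g" if p: "prime p" for p
  proof
    assume "p dvd ?g"
    then have "p dvd m" if "m \<in> M" for m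
      using that p by (metis Gcd_dvd dvd_trans imageI prime_dvd_power)
    then have "p dvd Gcd M" by (rule Gcd_greatest)
    then show False using assms p by (simp add: not_prime_unit)
  qed
  then have "is_unit ?g" by (metis dvd_0_right prime_divisor_exists two_is_prime)
  then show ?thesis by simp
qed

lemma Rats_common_denominator:
  fixes Q :: "real set"
  assumes "finite Q" "Q \<subseteq> \<rat>"
  shows "\<exists>N::int. N > 0 \<and> (\<forall>q\<in>Q. of_int N * q \<in> \<int>)"
  using assms
proof (induction Q rule: finite_induct)
  case empty
  show ?case by (intro exI[of _ 1]) simp
next
  case (insert x F)
  then obtain N :: int where N: "N > 0" "\<forall>q\<in>F. of_int N * q \<in> \<int>" by auto
  obtain i n where x: "n > 0" "x = of_int i / of_int n" using insert.prems by (auto elim: Rats_cases')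
  have "of_int (n * N) * q \<in> \<int>" if q: "q \<in> insert x F" for q :: real
  proof (cases "q = x")
    case True
    then have "of_int (n * N) * q = of_int (N * i)" using x by simp
    then show ?thesis by (metis Ints_of_int)
  next
    case False
    then have "of_int n * (of_int N * q) \<in> \<int>" using N q by (intro Ints_mult[of "of_int n"]) auto
    then show ?thesis by (simp add: mult.assoc)
  qed
  then show ?case using x N by (intro exI[of _ "n * N"]) auto
qed

text \<open>Clear the denominators of the ratios and divide by the gcd. The scale inherits the sign
  of \<open>\<mu>\<close>; since \<open>S\<close> is symmetric, it may be negated.\<close>

lemma commensurable_scaled_coprime_ints:
  fixes S :: "real set"
  assumes fin: "finite S" and sym: "\<And>l. l \<in> S \<Longrightarrow> - l \<in> S"
    and \<mu>: "\<mu> \<in> S" "\<mu> \<noteq> 0" and rat: "\<And>l. l \<in> S \<Longrightarrow> l / \<mu> \<in> \<rat>"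
  obtains \<omega> :: real and M :: "int set"
  where "\<omega> > 0" "S = (\<lambda>m. \<omega> * of_int m) ` M" "finite M" "Gcd M = 1"
proof -
  have "finite ((\<lambda>l. l / \<mu>) ` S)" "(\<lambda>l. l / \<mu>) ` S \<subseteq> \<rat>" using fin rat by auto
  from Rats_common_denominator[OF this] obtain N :: int
    where N: "N > 0" "\<And>l. l \<in> S \<Longrightarrow> of_int N * (l / \<mu>) \<in> \<int>" by auto
  define A where "A = (\<lambda>l. \<lfloor>of_int N * (l / \<mu>)\<rfloor>) ` S"
  have A: "of_int \<lfloor>of_int N * (l / \<mu>)\<rfloor> = of_int N * (l / \<mu>)" if "l \<in> S" for l
    using N(2)[OF that] by (simp add: of_int_floor_cancel)
  \<comment> \<open>\<open>\<mu>\<close> itself contributes \<open>N\<close>, so the gcd is not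
    0.\<close>
  have "N \<in> A" using \<mu> unfolding A_def by (intro image_eqI[of _ _ \<mu>]) auto
  then have G: "Gcd A > 0" using N(1)
    by (metis Gcd_0_iff Gcd_int_greater_eq_0 insert_absorb insert_subset less_le not_less_iff_gr_or_eq
        singletonD subsetD)
  define M where "M = (\<lambda>n. n div Gcd A) ` A"
  have AM: "A = (*) (Gcd A) ` M" by (auto simp: M_def image_image)
  have "Gcd A = normalize (Gcd A * Gcd M)" using Gcd_mult[of "Gcd A" M] AM by simp
  then have "Gcd A * Gcd M = Gcd A * 1" by (simp add: abs_mult)
  then have M1: "Gcd M = 1" using G by (metis less_irrefl mult_cancel_left)
  define \<omega> where "\<omega> = \<mu> * of_int (Gcd A) / of_int N"
  have S: "S = (\<lambda>m. \<omega> * of_int m) ` M"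
  proof -
    have "(\<lambda>m. \<omega> * of_int m) ` M = (\<lambda>n. \<mu> / of_int N * of_int n) ` A"
      unfolding \<omega>_def M_def image_image
      by (intro image_cong refl) (auto simp: real_of_int_div Gcd_dvd G)
    also have "\<dots> = (\<lambda>l. l) ` S"
      unfolding A_def image_image using N(1) \<mu>(2) by (intro image_cong refl) (simp only: A, simp)
    finally show ?thesis by simp
  qed
  have finM: "finite M" using fin by (simp add: M_def A_def)
  show ?thesis
  proof (cases "\<omega> > 0")
    case True
    then show ?thesis using that S finM M1 by blast
  next
    case False
    then have neg: "- \<omega> > 0" using \<mu>(2) G N(1)
      by (auto simp: \<omega>_def zero_less_mult_iff zero_less_divide_iff mult_less_0_iff divide_less_0_iff)
    have "S = uminus ` S" using sym by (force intro: image_eqI[of _ _ "- _"])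
    also have "\<dots> = (\<lambda>m. - \<omega> * of_int m) ` M" unfolding S by (simp add: image_image)
    finally show ?thesis using that neg finM M1 by blast
  qed
qed

section \<open>Phases of odd powers modulo 4\<close>

text \<open>Odd squares are 1 modulo 4, hence so is the even power
  \<open>m ^ (r - 1)\<close>.\<close>

lemma odd_power_diff_dvd_4:
  fixes m :: int
  assumes "odd m" "odd r"
  shows "4 dvd m ^ r - m"
proof -
  obtain j where r: "r = Suc (2 * j)" using \<open>odd r\<close> by (metis oddE Suc_eq_plus1)
  obtain i where m: "m = 2 * i + 1" using \<open>odd m\<close> by (rule oddE)
  have "m\<^sup>2 = 1 + 4 * (i * i + i)" by (simp add: m power2_eq_square algebra_simps)
  then have "m\<^sup>2 mod 4 = 1" by presburger
  then have "(m\<^sup>2) ^ j mod 4 = 1 mod 4" using power_mod[of "m\<^sup>2" 4 j] by simp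
  then have "4 dvd (m\<^sup>2) ^ j - 1" by (rule mod_eq_dvd_iff[THEN iffD1])
  moreover have "m ^ r - m = m * ((m\<^sup>2) ^ j - 1)" by (simp add: r power_mult right_diff_distrib)
  ultimately show ?thesis by simp
qed

text \<open>With \<open>\<theta> = 2 t / \<pi>\<close> one gets \<open>\<theta> m\<^sup>r \<in> \<int>\<close> on \<open>M\<close>, hence \<open>\<theta> \<in> \<int>\<close>, so only residues of
  \<open>m\<^sup>r\<close> modulo 4 matter; if \<open>\<theta>\<close> is odd, then all elements of \<open>M\<close> are odd.\<close>

lemma cis_odd_power_eq:
  fixes M :: "int set" and t :: real
  assumes M: "finite M" "Gcd M = 1" "\<And>m. m \<in> M \<Longrightarrow> - m \<in> M" and r: "odd r"
    and s: "\<And>m. m \<in> M \<Longrightarrow> s m = 1 \<or> s m = - 1"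
    and eq: "\<And>m. m \<in> M \<Longrightarrow> cis (- (t * of_int (m ^ r))) = \<gamma> * s m"
    and q: "odd q" and m: "m \<in> M"
  shows "cis (- (t * of_int (m ^ q))) = cis (- (t * of_int (m ^ r)))"
proof -
  \<comment> \<open>Squaring removes the signs and leaves one value common to all of
    \<open>M\<close>.\<close>
  have \<gamma>2: "cis (- (t * of_int (m ^ r))) ^ 2 = \<gamma>\<^sup>2" if "m \<in> M" for m
    using s[OF that] unfolding eq[OF that] by (auto simp: power_mult_distrib)
  have "2 * t / pi * of_int (m ^ r) \<in> \<int>" if "m \<in> M" for m
  proof -
    \<comment> \<open>As \<open>r\<close> is odd, \<open>m\<close> and \<open>- m\<close> have
      inverse phases. So the squared phase is its own inverse, and the fourth power is 1.\<close>
    have "cis (- (t * of_int (m ^ r))) ^ 2 = cis (t * of_int (m ^ r)) ^ 2"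
      using \<gamma>2[OF that] \<gamma>2[OF M(3)[OF that]] r by simp
    then have "cis (4 * t * of_int (m ^ r)) = 1"
      by (simp add: Complex.DeMoivre cis_divide[symmetric] divide_eq_1_iff)
        (metis (no_types, lifting) cis_divide cis_neq_zero diff_minus_eq_add divide_self
          mult.assoc mult_2 numeral_Bit0 distrib_right)
    then obtain n where "4 * t * of_int (m ^ r) = of_int n * (2 * pi)"
      unfolding cis_eq_1_iff by blast
    then have "2 * t / pi * of_int (m ^ r) = of_int n" by (simp add: field_simps)
    then show ?thesis by (metis Ints_of_int)
  qed
  then have "2 * t / pi * of_int (Gcd ((\<lambda>m. m ^ r) ` M)) \<in> \<int>"
    using M(1) by (intro Ints_mult_Gcd) auto
  then obtain k where "2 * t / pi = of_int k"
    using Gcd_power_image_eq_1[OF M(2)] by (auto elim: Ints_cases)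
  then have t: "t = of_int k * pi / 2" by (simp add: field_simps)
  \<comment> \<open>Since \<open>t\<close> is \<open>k * pi / 2\<close>, this makes the two angles
    differ by a multiple of \<open>2 * pi\<close>.\<close>
  have "4 dvd k * (m ^ r - m ^ q)"
  proof (cases "even k")
    case True
    have "even (m ^ r - m ^ q)" using r q odd_pos by auto
    then have "2 * 2 dvd k * (m ^ r - m ^ q)" using True by (rule mult_dvd_mono[rotated])
    then show ?thesis by simp
  next
    case False
    have val: "cis (- (t * of_int (n ^ r))) ^ 2 = (if even n then 1 else - 1)" for n
    proof -
      have "cis (- (t * of_int (n ^ r))) ^ 2 = cis (- (pi * of_int (k * n ^ r)))"
        by (simp add: Complex.DeMoivre t mult_ac)
      also have "\<dots> = (if even (k * n ^ r) then 1 else - 1)"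
      proof -
        have "cis (- (pi * of_int j)) = (if even j then 1 else - 1)" for j
          by (simp add: complex_eq_iff cos_npi_int sin_npi_int)
        then show ?thesis .
      qed
      finally show ?thesis using False r odd_pos by auto
    qed
    \<comment> \<open>By \<open>val\<close> the squared phase reveals the parity of
      \<open>n\<close>, and it is constant on \<open>M\<close>; a common even parity would
      contradict \<open>Gcd M = 1\<close>.\<close>
    have "odd n" if "n \<in> M" for n
    proof
      assume "even n"
      have "\<exists>n'\<in>M. odd n'"
      proof (rule ccontr)
        assume "\<not> ?thesis"
        then have "2 dvd Gcd M" by (intro Gcd_greatest) auto
        then show False using M(2) by simp
      qed
      then obtain n' where "n' \<in> M" "odd n'" by blast
      then show False using \<gamma>2[OF that] \<gamma>2[of n'] val[of n] val[of n'] \<open>even n\<close> by simp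
    qed
    then have "4 dvd (m ^ r - m) - (m ^ q - m)"
      using m r q by (intro dvd_diff odd_power_diff_dvd_4) auto
    then show ?thesis by simp
  qed
  then obtain i where i: "k * (m ^ r - m ^ q) = 4 * i" by (rule dvdE)
  have "cis (- (t * of_int (m ^ q))) = cis (- (t * of_int (m ^ r))) * cis (2 * pi * of_int i)"
  proof -
    have "real_of_int k * (of_int (m ^ r) - of_int (m ^ q)) = 4 * of_int i"
      using i by (metis of_int_diff of_int_mult of_int_numeral)
    then have "- (t * of_int (m ^ q)) = - (t * of_int (m ^ r)) + 2 * pi * of_int i"
      by (simp add: t field_simps)
    then show ?thesis by (simp only: cis_mult)
  qed
  then show ?thesis by simp
qed

subsection \<open>Transfer between odd powers\<close>

text \<open>At a nonzero coordinate of \<open>x\<close>, the quotient \<open>y $ u / x $ u\<close>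
  equals \<open>c / \<gamma>\<close>: real and unimodular, hence a sign.\<close>

lemma unit_scalars_real_vectors_sign:
  fixes x y :: "real^'v" and c \<gamma> :: complex
  assumes eq: "\<And>u. c * complex_of_real (x $ u) = \<gamma> * complex_of_real (y $ u)"
    and unit: "norm c = 1" "norm \<gamma> = 1" and "x \<noteq> 0"
  shows "\<exists>s::real. (s = 1 \<or> s = - 1) \<and> c = \<gamma> * s \<and> y = s *\<^sub>R x"
proof -
  obtain u where u: "x $ u \<noteq> 0" using \<open>x \<noteq> 0\<close> by (auto simp: vec_eq_iff)
  have abs: "\<bar>x $ u\<bar> = \<bar>y $ u\<bar>"
    using arg_cong[OF eq[of u], of norm] unit by (simp add: norm_mult)
  define s where "s = y $ u / x $ u"
  have s: "s = 1 \<or> s = - 1" using u abs by (auto simp: s_def abs_eq_iff)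
  have c: "c = \<gamma> * s" using eq[of u] u by (simp add: s_def field_simps)
  have "\<gamma> \<noteq> 0" using unit by auto
  then have "y $ w = s * x $ w" for w
    using eq[of w] unfolding c by (metis mult.assoc mult_cancel_left of_real_eq_iff of_real_mult)
  then show ?thesis using s c by (auto simp: vec_eq_iff)
qed

lemma Rats_of_odd_power_square:
  fixes x :: real
  assumes "x\<^sup>2 \<in> \<rat>" "x ^ r \<in> \<rat>" "odd r"
  shows "x \<in> \<rat>"
proof (cases "x = 0")
  case False
  obtain j where r: "r = Suc (2 * j)" using \<open>odd r\<close> by (metis oddE Suc_eq_plus1)
  have "x = x ^ r / (x\<^sup>2) ^ j" using False by (simp add: r power_mult)
  then show ?thesis using assms(1,2) by (metis Rats_divide Rats_power)
qed simp

lemma eig_supp_ratios_Rats: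
  fixes H :: "real^'v^'v"
  assumes sym: "transpose H = H" and rat: "\<And>u v. H $ u $ v \<in> \<rat>" and r: "odd r"
    and \<beta>: "\<And>l. l \<in> eig_supp H (axis a 1) \<Longrightarrow> \<exists>n::int. l ^ r = \<beta> * of_int n"
    and \<mu>: "\<mu> \<in> eig_supp H (axis a 1)" "\<mu> \<noteq> 0" and l: "l \<in> eig_supp H (axis a 1)"
  shows "l / \<mu> \<in> \<rat>"
proof -
  let ?S = "eig_supp H (axis a 1)"
  obtain n :: "real \<Rightarrow> int" where n: "\<And>l. l \<in> ?S \<Longrightarrow> l ^ r = \<beta> * of_int (n l)" using \<beta> by metis
  have fin: "finite ?S" using finite_Spec[OF sym] by (simp add: eig_supp_def)
  have n\<mu>: "\<beta> \<noteq> 0" "n \<mu> \<noteq> 0" using n[OF \<mu>(1)] \<mu>(2) by auto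
  \<comment> \<open>Scaling by \<open>\<beta>\<^sup>2\<close> is injective, so \<open>?T\<close>
    also counts each value once. Squares prevent cancellation: the sum over \<open>?T\<close> is a
    positive integer, by which one may divide.\<close>
  let ?T = "(\<lambda>l. (n l)\<^sup>2) ` ?S"
  have p2: "l ^ (2 * r) = \<beta>\<^sup>2 * of_int ((n l)\<^sup>2)" if "l \<in> ?S" for l
    using n[OF that] by (simp add: power_even_eq power_mult_distrib)
  have "(\<lambda>l. l ^ (2 * r)) ` ?S = (\<lambda>t. \<beta>\<^sup>2 * of_int t) ` ?T"
    unfolding image_image using p2 by (intro image_cong) auto
  moreover have "inj_on (\<lambda>t. \<beta>\<^sup>2 * real_of_int t) ?T" using n\<mu> by (auto simp: inj_on_def)
  ultimately have "\<Sum>((\<lambda>l. l ^ (2 * r)) ` ?S) = \<beta>\<^sup>2 * of_int (\<Sum>?T)"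
    by (simp add: sum.reindex sum_distrib_left)
  then have "\<beta>\<^sup>2 * of_int (\<Sum>?T) \<in> \<rat>"
    using eig_supp_power_sum_Rats[OF sym rat] by metis
  moreover have "\<Sum>?T > 0"
    using fin \<mu>(1) n\<mu> by (intro sum_pos2[of _ "(n \<mu>)\<^sup>2"]) auto
  ultimately have "\<exists>N::int. N > 0 \<and> \<beta>\<^sup>2 * of_int N \<in> \<rat>" by blast
  then obtain N :: int where N: "N > 0" "\<beta>\<^sup>2 * of_int N \<in> \<rat>" by blast
  then have "\<beta>\<^sup>2 * of_int N / of_int N \<in> \<rat>" by (intro Rats_divide) auto
  then have \<beta>2: "\<beta>\<^sup>2 \<in> \<rat>" using N(1) by simp
  have sq: "l\<^sup>2 \<in> \<rat>" if "l \<in> ?S" for l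
    using that r \<beta>2 p2[OF that]
    by (intro eigenvalue_square_Rats[OF sym rat, of l r]) (auto simp: eig_supp_def odd_pos)
  have "(l / \<mu>)\<^sup>2 \<in> \<rat>" using sq \<mu>(1) l by (simp add: power_divide)
  moreover have "(l / \<mu>) ^ r \<in> \<rat>" using n[OF l] n[OF \<mu>(1)] n\<mu> by (simp add: power_divide)
  ultimately show ?thesis using r by (rule Rats_of_odd_power_square)
qed

text \<open>\<open>r\<close> and \<open>q\<close> are interchangeable, so taking either of them to
  be 1 gives both directions of the equivalence.\<close>

lemma PST_mat_pow_odd_transfer:
  fixes H :: "real^'v^'v"
  assumes sym: "transpose H = H" and rat: "\<And>u v. H $ u $ v \<in> \<rat>"
    and supp: "\<And>l. l \<in> eig_supp H (axis a 1) \<Longrightarrow> - l \<in> eig_supp H (axis a 1)"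
    and "b \<noteq> a" and r: "odd r" and q: "odd q" and PST: "PST (mat_pow H r) a b"
  shows "PST (mat_pow H q) a b"
proof -
  let ?S = "eig_supp H (axis a 1)"
  define p where "p = (\<lambda>l v. orth_proj (eigenspace H l) (axis v 1))"
  have fin: "finite ?S" using finite_Spec[OF sym] by (simp add: eig_supp_def)
  obtain \<tau> \<gamma> where \<tau>: "\<tau> > 0" and \<gamma>: "norm \<gamma> = 1"
    and eq: "\<And>l u. l \<in> Spec H \<Longrightarrow> cis (- (\<tau> * l ^ r)) * complex_of_real (p l a $ u)
        = \<gamma> * complex_of_real (p l b $ u)"
    using PST unfolding PST_mat_pow_iff[OF sym] p_def by blast
  have "\<forall>l\<in>?S. \<exists>s::real. (s = 1 \<or> s = - 1) \<and> cis (- (\<tau> * l ^ r)) = \<gamma> * s \<and> p l b = s *\<^sub>R p l a"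
  proof
    fix l assume "l \<in> ?S"
    then have "l \<in> Spec H" "p l a \<noteq> 0" by (auto simp: eig_supp_def p_def)
    then show "\<exists>s::real. (s = 1 \<or> s = - 1) \<and> cis (- (\<tau> * l ^ r)) = \<gamma> * s \<and> p l b = s *\<^sub>R p l a"
      using unit_scalars_real_vectors_sign[OF eq norm_cis \<gamma>] by blast
  qed
  then obtain s :: "real \<Rightarrow> real" where s: "\<And>l. l \<in> ?S \<Longrightarrow> s l = 1 \<or> s l = - 1"
    and cs: "\<And>l. l \<in> ?S \<Longrightarrow> cis (- (\<tau> * l ^ r)) = \<gamma> * s l"
    and ps: "\<And>l. l \<in> ?S \<Longrightarrow> p l b = s l *\<^sub>R p l a" by metis
  have p0: "p l b = 0" if "l \<in> Spec H" "l \<notin> ?S" for l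
  proof -
    have "p l a = 0" using that by (simp add: eig_supp_def p_def)
    moreover have "\<gamma> \<noteq> 0" using \<gamma> by auto
    ultimately show ?thesis using eq[OF that(1)] by (simp add: vec_eq_iff)
  qed
  \<comment> \<open>If the support were contained in {0}, the single sign \<open>s 0\<close> would
    make \<open>axis b 1\<close> a multiple of \<open>axis a 1\<close>.\<close>
  obtain \<mu> where \<mu>: "\<mu> \<in> ?S" "\<mu> \<noteq> 0"
  proof (rule ccontr)
    assume "\<not> thesis"
    then have "?S \<subseteq> {0}" using that by blast
    then have "p l b = s 0 *\<^sub>R p l a" if "l \<in> Spec H" for l
      using that ps[of l] p0[of l] by (cases "l \<in> ?S") (auto simp: eig_supp_def p_def)
    then have "(\<Sum>l\<in>Spec H. p l b) = s 0 *\<^sub>R (\<Sum>l\<in>Spec H. p l a)"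
      by (simp add: scaleR_sum_right)
    then have "axis b 1 = s 0 *\<^sub>R (axis a 1 :: real^'v)"
      unfolding p_def symmetric_spectral_decomposition[OF sym] .
    then have "axis b 1 $ b = (s 0 *\<^sub>R (axis a 1 :: real^'v)) $ b" by simp
    then show False using \<open>b \<noteq> a\<close> by (simp add: axis_def)
  qed
  have "\<exists>n::int. l ^ r = pi / (2 * \<tau>) * of_int n" if l: "l \<in> ?S" for l
  proof -
    \<comment> \<open>The squares agree at \<open>l\<close> and \<open>- l\<close> because only
      signs differ; oddness of \<open>r\<close> then forces the fourth power of the phase to be
      1.\<close>
    have "cis (- (\<tau> * l ^ r)) ^ 2 = cis (- (\<tau> * (- l) ^ r)) ^ 2"
      unfolding cs[OF l] cs[OF supp[OF l]] using s[OF l] s[OF supp[OF l]]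
      by (auto simp: power_mult_distrib)
    then have "cis (- (2 * \<tau> * l ^ r)) = cis (2 * \<tau> * l ^ r)"
      using r by (simp add: Complex.DeMoivre mult.assoc)
    then have "cis (2 * \<tau> * l ^ r) / cis (- (2 * \<tau> * l ^ r)) = 1" by simp
    then have "cis (4 * \<tau> * l ^ r) = 1" by (simp add: cis_divide mult.assoc)
    then obtain n where "4 * \<tau> * l ^ r = of_int n * (2 * pi)" unfolding cis_eq_1_iff by blast
    then have "l ^ r = pi / (2 * \<tau>) * of_int n" using \<tau> by (simp add: field_simps)
    then show ?thesis by blast
  qed
  then have ratio: "l / \<mu> \<in> \<rat>" if "l \<in> ?S" for l
    by (rule eig_supp_ratios_Rats[OF sym rat r _ \<mu> that])
  obtain \<omega> M where \<omega>: "\<omega> > 0" and SM: "?S = (\<lambda>m. \<omega> * of_int m) ` M" and M: "finite M" "Gcd M = 1"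
    by (rule commensurable_scaled_coprime_ints[OF fin supp \<mu> ratio])
  have S: "\<omega> * of_int m \<in> ?S" if "m \<in> M" for m unfolding SM using that by (rule imageI)
  have negM: "- m \<in> M" if "m \<in> M" for m
  proof -
    have "- (\<omega> * of_int m) \<in> ?S" by (intro supp S that)
    then obtain m' where "m' \<in> M" "\<omega> * of_int m' = \<omega> * of_int (- m)"
      unfolding SM by auto
    then show ?thesis using \<omega> by (metis less_irrefl mult_cancel_left of_int_eq_iff)
  qed
  define t where "t = \<tau> * \<omega> ^ r"
  \<comment> \<open>Chosen so that \<open>\<tau>' * l ^ q = t * m ^ q\<close> for
    \<open>l = \<omega> * m\<close>, parallel to \<open>\<tau> * l ^ r = t * m ^ r\<close>.\<close>
  define \<tau>' where "\<tau>' = t / \<omega> ^ q"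
  have cis_eq: "cis (- (\<tau>' * l ^ q)) = \<gamma> * s l" if "l \<in> ?S" for l
  proof -
    have tr: "\<tau> * (\<omega> * of_int m) ^ r = t * of_int (m ^ r)" for m
      by (simp add: t_def power_mult_distrib)
    from that obtain m where m: "l = \<omega> * of_int m" "m \<in> M" unfolding SM by (elim imageE)
    have "\<tau>' * l ^ q = t * of_int (m ^ q)" using \<omega> by (simp add: m(1) \<tau>'_def power_mult_distrib)
    moreover have "cis (- (t * of_int (m ^ q))) = cis (- (t * of_int (m ^ r)))"
    proof (rule cis_odd_power_eq[OF M negM r _ _ q m(2)])
      show "complex_of_real (s (\<omega> * of_int m)) = 1 \<or> complex_of_real (s (\<omega> * of_int m)) = - 1"
        if "m \<in> M" for m using s[OF S[OF that]] by auto
      show "cis (- (t * of_int (m ^ r))) = \<gamma> * complex_of_real (s (\<omega> * of_int m))"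
        if "m \<in> M" for m using cs[OF S[OF that]] by (simp only: tr)
    qed
    ultimately show ?thesis using cs[OF that] by (simp only: m(1) tr)
  qed
  have "cis (- (\<tau>' * l ^ q)) * complex_of_real (p l a $ u) = \<gamma> * complex_of_real (p l b $ u)"
    if "l \<in> Spec H" for l u
  proof (cases "l \<in> ?S")
    case True
    then show ?thesis by (simp add: cis_eq ps)
  next
    case False
    then have "p l a = 0" using that by (simp add: eig_supp_def p_def)
    then show ?thesis using p0[OF that False] by simp
  qed
  moreover have "\<tau>' > 0" using \<tau> \<omega> by (simp add: \<tau>'_def t_def)
  ultimately show ?thesis
    using \<gamma> unfolding PST_mat_pow_iff[OF sym] p_def by blast
qed

section \<open>Bipartite graphs\<close>

text \<open>Changing the sign of an eigenvector on one colour class negates the eigenvalue and keeps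
  the coordinate at \<open>a\<close> nonzero.\<close>

lemma bipartite_eig_supp_symmetric:
  fixes E :: "'v::finite rel"
  assumes sym: "transpose (adj_matrix E) = adj_matrix E" and "bipartite E"
    and l: "l \<in> eig_supp (adj_matrix E) (axis a 1)"
  shows "- l \<in> eig_supp (adj_matrix E) (axis a 1)"
proof -
  obtain X where X: "\<And>u v. (u, v) \<in> E \<Longrightarrow> u \<in> X \<longleftrightarrow> v \<notin> X"
    using \<open>bipartite E\<close> unfolding bipartite_def by blast
  obtain z where z: "adj_matrix E *v z = l *\<^sub>R z" "z $ a \<noteq> 0"
    using l eig_supp_axis_iff[OF sym] by blast
  define d :: "'v \<Rightarrow> real" where "d u = (if u \<in> X then 1 else - 1)" for u
  define y where "y = (\<chi> u. d u * z $ u)"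
  have "adj_matrix E $ u $ v * d v = - d u * adj_matrix E $ u $ v" for u v
    using X by (auto simp: adj_matrix_def d_def)
  then have "(adj_matrix E *v y) $ u = - d u * (adj_matrix E *v z) $ u" for u
    by (simp add: matrix_vector_mult_def y_def sum_distrib_left flip: mult.assoc)
  then have "adj_matrix E *v y = (- l) *\<^sub>R y" using z(1) by (simp add: vec_eq_iff y_def)
  moreover have "y $ a \<noteq> 0" using z(2) by (simp add: y_def d_def)
  ultimately show ?thesis using eig_supp_axis_iff[OF sym] by blast
qed

theorem theorem1p4:
  shows "(\<forall>(H :: real^'v^'v) (a :: 'v).
            rational_symmetric H \<and> eig_supp H (axis a 1) = uminus ` eig_supp H (axis a 1) \<longrightarrow>
            (\<forall>(b :: 'v) (r :: nat). b \<noteq> a \<and> 0 < r \<and> odd r \<longrightarrow>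
               (PST (mat_pow H r) a b \<longleftrightarrow> PST H a b)))
       \<and> (\<forall>(E :: 'v rel) (a :: 'v) (b :: 'v) (r :: nat).
            simple_graph E \<and> bipartite E \<and> a \<noteq> b \<and> 0 < r \<and> odd r \<longrightarrow>
            (PST (mat_pow (adj_matrix E) r) a b \<longleftrightarrow> PST (adj_matrix E) a b))"
proof -
  have main: "PST (mat_pow H r) a b \<longleftrightarrow> PST H a b"
    if H: "rational_symmetric H" and supp: "\<And>l. l \<in> eig_supp H (axis a 1) \<Longrightarrow> - l \<in> eig_supp H (axis a 1)"
      and "b \<noteq> a" "odd r" for H :: "real^'v^'v" and a b :: 'v and r
  proof -
    have "transpose H = H" "\<And>u v. H $ u $ v \<in> \<rat>" using H by (auto simp: rational_symmetric_def)
    note transfer = PST_mat_pow_odd_transfer[OF this supp \<open>b \<noteq> a\<close>]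
    have "PST (mat_pow H r) a b \<longleftrightarrow> PST (mat_pow H 1) a b"
      using transfer[of r 1] transfer[of 1 r] \<open>odd r\<close> by auto
    then show ?thesis by simp
  qed
  have neg: "- l \<in> eig_supp H (axis a 1)"
    if "eig_supp H (axis a 1) = uminus ` eig_supp H (axis a 1)" "l \<in> eig_supp H (axis a 1)"
    for l a and H :: "real^'v^'v"
    using that by (metis imageI)
  have adj: "transpose (adj_matrix E) = adj_matrix E" if "simple_graph E" for E :: "'v rel"
    using that by (auto simp: simple_graph_def sym_def adj_matrix_def transpose_def vec_eq_iff)
  have rs: "rational_symmetric (adj_matrix E)" if "simple_graph E" for E :: "'v rel"
    using adj[OF that] by (simp add: rational_symmetric_def adj_matrix_def)
  show ?thesis
  proof (intro conjI allI impI)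
    fix H :: "real^'v^'v" and a b :: 'v and r :: nat
    assume "rational_symmetric H \<and> eig_supp H (axis a 1) = uminus ` eig_supp H (axis a 1)"
      and "b \<noteq> a \<and> 0 < r \<and> odd r"
    then show "PST (mat_pow H r) a b \<longleftrightarrow> PST H a b" by (intro main[OF _ neg]) blast+
  next
    fix E :: "'v rel" and a b :: 'v and r :: nat
    assume E: "simple_graph E \<and> bipartite E \<and> a \<noteq> b \<and> 0 < r \<and> odd r"
    then have "simple_graph E" "bipartite E" "b \<noteq> a" "odd r" by auto
    then show "PST (mat_pow (adj_matrix E) r) a b \<longleftrightarrow> PST (adj_matrix E) a b"
      using main[OF rs bipartite_eig_supp_symmetric[OF adj]] by blast
  qed
qed

end
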